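(* Let $\mathcal{H}\subset\mathbb{Z}_{\ge 0}$ and $N\in\mathbb{N}$. Assume there exist finite constants $L_N<U_N$ (which may depend on $N$ and $\mathcal{H}$) such that for all integers $0\le s\le N$ with $\mathbb{P}_s(A_N)>0$, $$L_N<\mathbb{E}_s\big[T-\omega_N\,\big|\,A_N\big]<U_N.$$ Then, for every integer $0\le s\le N$ with $\mathbb{P}_s(A_N)>0$, $$0<E(s)-\bigl(E_N(s)+L_N\,\mathbb{P}_s(A_N)\bigr)<(U_N-L_N)\,\mathbb{P}_s(A_N).$$
   Context: Let $X_1,X_2,\dots$ be i.i.d. uniform on $\{1,\dots,6\}$. For $s\in\mathbb{Z}_{\ge0}$ let $S_t=s+\sum_{i=1}^t X_i$, $S_0=s$; $\mathbb{P}_s,\mathbb{E}_s$ denote probability and expectation with $S_0=s$. Define $T=\inf\{t\ge0:S_t\in\mathcal{H}\}$ (with $\inf\emptyset=\infty$), $\omega_N=\inf\{t\ge0:S_t>N\}$, the overshoot event $A_N=\{\omega_N<T\}$, and $E(s)=\mathbb{E}_s[T]\in[0,\infty]$. The truncated expectation $E_N:\mathbb{Z}_{\ge0}\to[0,\infty)$ is the function determined by backward substitution from: $E_N(s)=0$ if $s>N$; $E_N(s)=0$ if $s\le N$ and $s\in\mathcal{H}$; $E_N(s)=1+\frac16\sum_{i=1}^6E_N(s+i)$ if $0\le s\le N$ and $s\notin\mathcal{H}$. *)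

theory Defs
  imports "HOL-Probability.Probability"
begin

definition iid_dice :: "'a measure \<Rightarrow> (nat \<Rightarrow> 'a \<Rightarrow> nat) \<Rightarrow> bool" where
  "iid_dice M X \<longleftrightarrow>
     prob_space M \<and>
     prob_space.indep_vars M (\<lambda>_. count_space UNIV) X {1..} \<and>
     (\<forall>i\<ge>1. distr M (count_space UNIV) (X i) = measure_pmf (pmf_of_set {1..6}))"

text \<open>The starting point \<open>s\<close> is an argument of the walk, so the law written with index \<open>s\<close>
  on paper is the fixed measure \<open>M\<close> applied to the walk started at \<open>s\<close>.\<close>

definition walk :: "(nat \<Rightarrow> 'a \<Rightarrow> nat) \<Rightarrow> nat \<Rightarrow> nat \<Rightarrow> 'a \<Rightarrow> nat" where
  "walk X s t x = s + (\<Sum>i=1..t. X i x)"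

text \<open>In \<^typ>\<open>enat\<close> the infimum of the empty set is \<open>\<infinity>\<close>.\<close>

definition hit_time :: "(nat \<Rightarrow> 'a \<Rightarrow> nat) \<Rightarrow> nat set \<Rightarrow> nat \<Rightarrow> 'a \<Rightarrow> enat" where
  "hit_time X H s x = Inf (enat ` {t. walk X s t x \<in> H})"

definition exceed_time :: "(nat \<Rightarrow> 'a \<Rightarrow> nat) \<Rightarrow> nat \<Rightarrow> nat \<Rightarrow> 'a \<Rightarrow> enat" where
  "exceed_time X N s x = Inf (enat ` {t. walk X s t x > N})"

definition overshoot ::
    "'a measure \<Rightarrow> (nat \<Rightarrow> 'a \<Rightarrow> nat) \<Rightarrow> nat set \<Rightarrow> nat \<Rightarrow> nat \<Rightarrow> 'a set" where
  "overshoot M X H N s = {x \<in> space M. exceed_time X N s x < hit_time X H s x}"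

definition expected_hit_time ::
    "'a measure \<Rightarrow> (nat \<Rightarrow> 'a \<Rightarrow> nat) \<Rightarrow> nat set \<Rightarrow> nat \<Rightarrow> ennreal" where
  "expected_hit_time M X H s = (\<integral>\<^sup>+ x. ennreal_of_enat (hit_time X H s x) \<partial>M)"

text \<open>The conditional expectation given the overshoot event is the expectation under the
  conditioned measure \<^const>\<open>uniform_measure\<close>. That measure is concentrated on the event, where
  the exceedance time is finite and smaller than the hitting time, so the subtraction on
  \<^typ>\<open>enat\<close> is never truncated there.\<close>

definition cond_expected_excess ::
    "'a measure \<Rightarrow> (nat \<Rightarrow> 'a \<Rightarrow> nat) \<Rightarrow> nat set \<Rightarrow> nat \<Rightarrow> nat \<Rightarrow> ennreal" where
  "cond_expected_excess M X H N s =
     (\<integral>\<^sup>+ x. ennreal_of_enat (hit_time X H s x - exceed_time X N s x)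
        \<partial>uniform_measure M (overshoot M X H N s))"

function trunc_expectation :: "nat set \<Rightarrow> nat \<Rightarrow> nat \<Rightarrow> real" where
  "trunc_expectation H N s =
     (if s > N then 0
      else if s \<in> H then 0
      else 1 + 1/6 * (\<Sum>i=1..6. trunc_expectation H N (s + i)))"
  by pat_completeness auto
termination
  by (relation "Wellfounded.measure (\<lambda>(H, N, s). Suc N - s)") auto

declare trunc_expectation.simps [simp del]

end

theory Submission
  imports Defs
begin

text \<open>
  Write \<open>\<tau> = min T \<omega>\<^sub>N\<close> for the time at which the walk either hits \<open>H\<close> or exceeds \<open>N\<close>. Pathwise
  \<open>T = \<tau> + (T - \<omega>\<^sub>N)\<close> with truncated subtraction (\<open>min_plus_excess_eq\<close>), and the second summand is
  almost surely zero off the overshoot event, because \<open>\<omega>\<^sub>N\<close> is almost surely finite. Taking expectations,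
  \<open>E(s) = E[\<tau>] + P(A\<^sub>N) \<cdot> E[T - \<omega>\<^sub>N | A\<^sub>N]\<close>. If \<open>E[\<tau>]\<close> is the truncated expectation \<open>E\<^sub>N(s)\<close>, the
  theorem is the assumed bound on the conditional expectation multiplied by \<open>P(A\<^sub>N) > 0\<close>.

  The identity \<open>E[\<tau>] = E\<^sub>N(s)\<close> (\<open>expectation_stopping_time\<close>) is the probabilistic content. Instead
  of restarting the walk after its first step, which would need a shifted sequence of dice, the
  proof runs forwards in time. The quantity \<open>b\<^sub>t = E[E\<^sub>N(S\<^sub>t); \<tau> > t]\<close> satisfies
  \<open>b\<^sub>t = P(\<tau> > t) + b\<^bsub>t+1\<^esub>\<close> (\<open>surviving_mass_step\<close>): the recursion for \<open>E\<^sub>N\<close> applies at the surviving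
  position \<open>S\<^sub>t\<close>, the average over the next roll is the effect of the independent die \<open>X\<^bsub>t+1\<^esub>\<close>
  (\<open>nn_integral_next_roll\<close>), and \<open>E\<^sub>N\<close> vanishes at every stopped position. As each roll is almost
  surely at least \<open>1\<close>, survival beyond time \<open>N\<close> has probability zero, so the telescoping sum
  terminates and gives
  \<open>E\<^sub>N(s) = b\<^sub>0 = \<Sum>\<^sub>t P(\<tau> > t) = E[\<tau>]\<close>.
\<close>

text \<open>Rolls are indexed from \<open>1\<close>. Rewriting \<open>1\<close> to \<open>Suc 0\<close> would stop lemmas about the index sets
  \<open>{1..t}\<close> and the die \<open>{1..6}\<close> from matching.\<close>
declare One_nat_def [simp del]

section \<open>The truncated expectation\<close>

lemma trunc_expectation_stopped:
  "n > N \<or> n \<in> H \<Longrightarrow> trunc_expectation H N n = 0"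
  by (subst trunc_expectation.simps) auto

lemma trunc_expectation_running:
  "n \<le> N \<Longrightarrow> n \<notin> H \<Longrightarrow>
     trunc_expectation H N n = 1 + 1/6 * (\<Sum>i=1..6. trunc_expectation H N (n + i))"
  by (subst trunc_expectation.simps) auto

lemma trunc_expectation_nonneg: "trunc_expectation H N n \<ge> 0"
proof (induction H N n rule: trunc_expectation.induct)
  case (1 H N n)
  then show ?case
    by (subst trunc_expectation.simps) (auto intro!: add_nonneg_nonneg sum_nonneg divide_nonneg_nonneg)
qed

lemma ennreal_trunc_expectation_running:
  assumes "n \<le> N" "n \<notin> H"
  shows "ennreal (trunc_expectation H N n) =
           1 + (\<Sum>i=1..6. ennreal (trunc_expectation H N (n + i))) / 6"
proof -
  have "(\<Sum>i=1..6. ennreal (trunc_expectation H N (n + i))) / 6 =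
          ennreal ((\<Sum>i=1..6. trunc_expectation H N (n + i)) / 6)"
    by (subst sum_ennreal)
      (auto simp: trunc_expectation_nonneg sum_nonneg divide_ennreal[symmetric])
  then show ?thesis
    using trunc_expectation_running[OF assms]
    by (simp add: sum_nonneg trunc_expectation_nonneg)
qed

section \<open>Rolls, their history and independence\<close>

abbreviation history :: "(nat \<Rightarrow> 'a \<Rightarrow> nat) \<Rightarrow> nat \<Rightarrow> 'a \<Rightarrow> nat \<Rightarrow> nat" where
  "history X t x \<equiv> restrict (\<lambda>i. X i x) {1..t}"

abbreviation histories :: "nat \<Rightarrow> (nat \<Rightarrow> nat) measure" where
  "histories t \<equiv> PiM {1..t} (\<lambda>_. count_space UNIV)"

text \<open>A finite history takes countably many values, so every function of it is measurable. This
  settles measurability of all events and positions determined by the first \<open>t\<close> rolls.\<close>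

lemma histories_eq_count_space: "histories t = count_space ({1..t} \<rightarrow>\<^sub>E UNIV)"
  by (rule count_space_PiM_finite) auto

lemma measurable_histories:
  "g \<in> histories t \<rightarrow>\<^sub>M count_space UNIV" "g' \<in> histories t \<rightarrow>\<^sub>M (borel :: ennreal measure)"
  unfolding histories_eq_count_space by auto

lemma measurable_histories_pair:
  "g \<in> (histories t \<Otimes>\<^sub>M PiM {n} (\<lambda>_. count_space (UNIV :: nat set))) \<rightarrow>\<^sub>M (borel :: ennreal measure)"
  unfolding histories_eq_count_space
  by (subst count_space_PiM_finite, simp, simp, subst pair_measure_countable)
    (auto intro!: countable_PiE)

lemma iid_dice_prob_space: "iid_dice M X \<Longrightarrow> prob_space M"
  by (simp add: iid_dice_def)

lemma measurable_roll: "iid_dice M X \<Longrightarrow> i \<ge> 1 \<Longrightarrow> X i \<in> M \<rightarrow>\<^sub>M count_space UNIV"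
  by (auto simp: iid_dice_def prob_space.indep_vars_def2)

lemma measurable_history: "iid_dice M X \<Longrightarrow> history X t \<in> M \<rightarrow>\<^sub>M histories t"
  by (intro measurable_restrict measurable_roll) auto

lemma walk_eq_history:
  assumes "j \<le> t"
  shows "walk X s j x = walk (\<lambda>i y. y i) s j (history X t x)"
  using assms by (auto simp: walk_def intro!: sum.cong)

lemma measurable_walk: "iid_dice M X \<Longrightarrow> walk X s t \<in> M \<rightarrow>\<^sub>M count_space UNIV"
  using measurable_compose[OF measurable_history measurable_histories(1),
      of M X "walk (\<lambda>i y. y i) s t" t]
  by (simp flip: walk_eq_history)

lemma AE_walk_ge:
  assumes "iid_dice M X"
  shows "AE x in M. t \<le> walk X s t x"
proof -
  have "AE x in M. X i x \<ge> 1" if "i \<ge> 1" for i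
  proof (rule AE_distrD[OF measurable_roll[OF assms that]])
    have "distr M (count_space UNIV) (X i) = measure_pmf (pmf_of_set {1..6})"
      using assms that by (simp add: iid_dice_def)
    moreover have "AE n in measure_pmf (pmf_of_set {1..6::nat}). n \<ge> 1"
      by (simp add: AE_measure_pmf_iff)
    ultimately show "AE n in distr M (count_space UNIV) (X i). n \<ge> 1"
      by (simp only:)
  qed
  then have "AE x in M. \<forall>i\<in>{1..t}. X i x \<ge> 1"
    by (subst AE_finite_all) auto
  then show ?thesis
  proof eventually_elim
    case (elim x)
    have "(\<Sum>i=1..t. 1) \<le> (\<Sum>i=1..t. X i x)"
      using elim by (intro sum_mono) auto
    then show ?case by (simp add: walk_def)
  qed
qed

text \<open>The roll after time \<open>t\<close> is independent of the history, so Fubini's theorem replaces it by the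
  average over the six faces. This is the only use made of independence.\<close>

lemma nn_integral_next_roll:
  fixes g :: "(nat \<Rightarrow> nat) \<Rightarrow> nat \<Rightarrow> ennreal"
  assumes dice: "iid_dice M X"
  shows "(\<integral>\<^sup>+ x. g (history X t x) (X (Suc t) x) \<partial>M) =
           (\<integral>\<^sup>+ x. (\<Sum>i=1..6. g (history X t x) i) / 6 \<partial>M)"
proof -
  interpret prob_space M by (rule iid_dice_prob_space[OF dice])
  let ?C = "count_space UNIV :: nat measure"
  let ?N = "PiM {Suc t} (\<lambda>_. ?C)" and ?next = "\<lambda>x. restrict (\<lambda>i. X i x) {Suc t}"
  let ?g = "\<lambda>p. g (fst p) (snd p (Suc t))"
  have history: "history X t \<in> M \<rightarrow>\<^sub>M histories t" and roll: "X (Suc t) \<in> M \<rightarrow>\<^sub>M ?C"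
    using dice by (auto intro: measurable_history measurable_roll)
  have "next": "?next \<in> M \<rightarrow>\<^sub>M ?N"
    using roll by (intro measurable_restrict) auto
  have coordinate: "(\<lambda>z. h (z (Suc t))) \<in> borel_measurable ?N" for h :: "nat \<Rightarrow> ennreal"
    by (rule measurable_compose[OF measurable_component_singleton]) auto
  have die: "distr M ?C (X (Suc t)) = measure_pmf (pmf_of_set {1..6})"
    using dice by (simp add: iid_dice_def)
  have average: "(\<integral>\<^sup>+ z. h (z (Suc t)) \<partial>distr M ?N ?next) = (\<Sum>i=1..6. h i) / 6"
    for h :: "nat \<Rightarrow> ennreal"
  proof -
    have "(\<integral>\<^sup>+ z. h (z (Suc t)) \<partial>distr M ?N ?next) = (\<integral>\<^sup>+ x. h (X (Suc t) x) \<partial>M)"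
      by (subst nn_integral_distr[OF "next"]) (simp_all add: coordinate)
    also have "\<dots> = (\<integral>\<^sup>+ i. h i \<partial>distr M ?C (X (Suc t)))"
      by (subst nn_integral_distr[OF roll]) auto
    finally show ?thesis
      by (simp add: die nn_integral_pmf_of_set)
  qed
  have "indep_var (histories t) (history X t) ?N ?next"
    using dice by (intro indep_var_restrict[where I="{1..}"]) (auto simp: iid_dice_def)
  then have joint: "distr M (histories t) (history X t) \<Otimes>\<^sub>M distr M ?N ?next =
      distr M (histories t \<Otimes>\<^sub>M ?N) (\<lambda>x. (history X t x, ?next x))"
    by (simp add: indep_var_distribution_eq)
  have "(\<integral>\<^sup>+ x. g (history X t x) (X (Suc t) x) \<partial>M) =
      (\<integral>\<^sup>+ p. ?g p \<partial>distr M (histories t \<Otimes>\<^sub>M ?N) (\<lambda>x. (history X t x, ?next x)))"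
    by (subst nn_integral_distr[OF measurable_Pair[OF history "next"]])
      (simp_all add: measurable_histories_pair)
  also have "\<dots> = (\<integral>\<^sup>+ p. ?g p \<partial>(distr M (histories t) (history X t) \<Otimes>\<^sub>M distr M ?N ?next))"
    by (simp only: joint)
  also have "\<dots> = (\<integral>\<^sup>+ y. (\<integral>\<^sup>+ z. ?g (y, z) \<partial>distr M ?N ?next) \<partial>distr M (histories t) (history X t))"
  proof (rule sigma_finite_measure.nn_integral_fst[symmetric])
    show "sigma_finite_measure (distr M ?N ?next)"
      using prob_space_distr[OF "next"] by (simp add: prob_space_imp_sigma_finite)
    have sets_eq: "sets (distr M (histories t) (history X t) \<Otimes>\<^sub>M distr M ?N ?next) =
        sets (histories t \<Otimes>\<^sub>M ?N)"
      by (intro sets_pair_measure_cong) auto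
    show "?g \<in> borel_measurable (distr M (histories t) (history X t) \<Otimes>\<^sub>M distr M ?N ?next)"
      unfolding measurable_cong_sets[OF sets_eq refl] by (rule measurable_histories_pair)
  qed
  also have "\<dots> = (\<integral>\<^sup>+ y. (\<Sum>i=1..6. g y i) / 6 \<partial>distr M (histories t) (history X t))"
    by (simp add: average)
  also have "\<dots> = (\<integral>\<^sup>+ x. (\<Sum>i=1..6. g (history X t x) i) / 6 \<partial>M)"
    by (rule nn_integral_distr[OF history]) (simp add: measurable_histories(2))
  finally show ?thesis .
qed

section \<open>The first time of hitting the target or exceeding the bound\<close>

definition survives :: "(nat \<Rightarrow> 'a \<Rightarrow> nat) \<Rightarrow> nat set \<Rightarrow> nat \<Rightarrow> nat \<Rightarrow> nat \<Rightarrow> 'a \<Rightarrow> bool" where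
  "survives X H N s t x \<longleftrightarrow> (\<forall>j\<le>t. walk X s j x \<le> N \<and> walk X s j x \<notin> H)"

lemma survives_eq_history:
  "survives X H N s t x = survives (\<lambda>i y. y i) H N s t (history X t x)"
  unfolding survives_def by (metis walk_eq_history)

lemma less_Inf_enat_iff: "enat t < Inf (enat ` A) \<longleftrightarrow> (\<forall>j\<le>t. j \<notin> A)"
proof (cases "A = {}")
  case True
  then show ?thesis by (simp add: Inf_enat_def)
next
  case False
  then obtain k where "enat k \<in> enat ` A" by blast
  then have "(LEAST y. y \<in> enat ` A) \<in> enat ` A" by (rule LeastI)
  then have "Inf (enat ` A) \<in> enat ` A"
    using False by (simp add: Inf_enat_def)
  then obtain n where n: "n \<in> A" "Inf (enat ` A) = enat n" by auto
  have "n \<le> j" if "j \<in> A" for j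
    using Inf_lower[of "enat j" "enat ` A"] that n(2) by simp
  then show ?thesis using n(1) unfolding n(2) enat_ord_simps by (meson less_le_trans not_le)
qed

lemma less_stopping_time_iff:
  "enat t < min (hit_time X H s x) (exceed_time X N s x) \<longleftrightarrow> survives X H N s t x"
  unfolding hit_time_def exceed_time_def survives_def min_less_iff_conj less_Inf_enat_iff
    mem_Collect_eq not_less
  by blast

lemma measurable_Inf_enat:
  assumes "\<And>t. Measurable.pred M (P t)"
  shows "(\<lambda>x. Inf (enat ` {t. P t x})) \<in> M \<rightarrow>\<^sub>M count_space UNIV"
proof -
  have eq: "Inf (enat ` {t. P t x}) = (if \<exists>t. P t x then enat (LEAST t. P t x) else \<infinity>)" for x
  proof (cases "\<exists>t. P t x")
    case True
    then have "Inf (enat ` {t. P t x}) = enat (LEAST t. P t x)"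
      by (intro antisym Inf_lower Inf_greatest) (auto intro: LeastI Least_le)
    with True show ?thesis by simp
  qed (simp add: Inf_enat_def)
  note [measurable] = assms
  show ?thesis unfolding eq by measurable
qed

lemma measurable_compose2_countable:
  fixes f g :: "'a \<Rightarrow> 'b::countable"
  assumes "f \<in> M \<rightarrow>\<^sub>M count_space UNIV" "g \<in> M \<rightarrow>\<^sub>M count_space UNIV"
  shows "(\<lambda>x. h (f x) (g x)) \<in> M \<rightarrow>\<^sub>M count_space UNIV"
  by (rule measurable_compose_countable[OF _ assms(1)], rule measurable_compose[OF assms(2)]) auto

lemma measurable_hit_time:
  assumes "iid_dice M X"
  shows "hit_time X H s \<in> M \<rightarrow>\<^sub>M count_space UNIV"
  unfolding hit_time_def
  by (intro measurable_Inf_enat measurable_compose[OF measurable_walk[OF assms]]) auto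

lemma measurable_exceed_time:
  assumes "iid_dice M X"
  shows "exceed_time X N s \<in> M \<rightarrow>\<^sub>M count_space UNIV"
  unfolding exceed_time_def
  by (intro measurable_Inf_enat measurable_compose[OF measurable_walk[OF assms]]) auto

lemma sets_survives:
  assumes "iid_dice M X"
  shows "{x \<in> space M. survives X H N s t x} \<in> sets M"
proof -
  have "Measurable.pred M (survives X H N s t)"
    using measurable_compose[OF measurable_history[OF assms, of t] measurable_histories(1),
        of "survives (\<lambda>i y. y i) H N s t"]
    by (simp flip: survives_eq_history)
  then show ?thesis by (simp add: pred_def)
qed

text \<open>The quantity \<open>b\<^sub>t\<close> of the introduction: the expected time still to come after \<open>t\<close>, as predicted
  by the truncated expectation at the position reached.\<close>

definition surviving_mass ::
    "'a measure \<Rightarrow> (nat \<Rightarrow> 'a \<Rightarrow> nat) \<Rightarrow> nat set \<Rightarrow> nat \<Rightarrow> nat \<Rightarrow> nat \<Rightarrow> ennreal" where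
  "surviving_mass M X H N s t =
     (\<integral>\<^sup>+ x. ennreal (trunc_expectation H N (walk X s t x)) *
              indicator {x. survives X H N s t x} x \<partial>M)"

text \<open>On survival the recursion for the truncated expectation applies to the current position and
  produces the average over the next roll; if the next position is a stopped one, it contributes
  zero, so survival up to time \<open>t\<close> may be replaced by survival up to time \<open>Suc t\<close>.\<close>

lemma surviving_mass_step:
  assumes dice: "iid_dice M X"
  shows "surviving_mass M X H N s t =
           emeasure M {x \<in> space M. survives X H N s t x} + surviving_mass M X H N s (Suc t)"
proof -
  define F where "F n = ennreal (trunc_expectation H N n)" for n
  define pos where "pos = walk (\<lambda>i y. y i) s t"
  define alive where "alive = {y. survives (\<lambda>i y. y i) H N s t y}"
  define g where "g y i = F (pos y + i) * indicator alive y" for y :: "nat \<Rightarrow> nat" and i :: nat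
  have pos: "walk X s t x = pos (history X t x)" for x
    unfolding pos_def by (rule walk_eq_history) simp
  have alive: "survives X H N s t x \<longleftrightarrow> history X t x \<in> alive" for x
    unfolding alive_def by (simp flip: survives_eq_history)
  have "surviving_mass M X H N s t = (\<integral>\<^sup>+ x. indicator {x \<in> space M. survives X H N s t x} x +
                       (\<Sum>i=1..6. g (history X t x) i) / 6 \<partial>M)"
    unfolding surviving_mass_def
  proof (rule nn_integral_cong)
    fix x assume "x \<in> space M"
    have "F (walk X s t x) = 1 + (\<Sum>i=1..6. F (walk X s t x + i)) / 6"
      if "survives X H N s t x"
      using that ennreal_trunc_expectation_running[of "walk X s t x" N H]
      unfolding F_def survives_def by blast
    with \<open>x \<in> space M\<close>
    show "ennreal (trunc_expectation H N (walk X s t x)) * indicator {x. survives X H N s t x} x =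
      indicator {x \<in> space M. survives X H N s t x} x + (\<Sum>i=1..6. g (history X t x) i) / 6"
      unfolding F_def[symmetric] g_def by (auto simp: alive pos indicator_def)
  qed
  also have "\<dots> = emeasure M {x \<in> space M. survives X H N s t x} +
      (\<integral>\<^sup>+ x. (\<Sum>i=1..6. g (history X t x) i) / 6 \<partial>M)"
    using sets_survives[OF dice]
    by (subst nn_integral_add)
      (auto intro!: measurable_compose[OF measurable_history[OF dice] measurable_histories(2)])
  also have "(\<integral>\<^sup>+ x. (\<Sum>i=1..6. g (history X t x) i) / 6 \<partial>M) =
      (\<integral>\<^sup>+ x. g (history X t x) (X (Suc t) x) \<partial>M)"
    by (rule nn_integral_next_roll[OF dice, symmetric])
  also have "\<dots> = surviving_mass M X H N s (Suc t)"
    unfolding surviving_mass_def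
  proof (rule nn_integral_cong)
    fix x
    have next_walk: "pos (history X t x) + X (Suc t) x = walk X s (Suc t) x"
      by (simp add: pos[symmetric]) (simp add: walk_def)
    have "survives X H N s (Suc t) x \<longleftrightarrow> survives X H N s t x \<and>
            walk X s (Suc t) x \<le> N \<and> walk X s (Suc t) x \<notin> H"
      unfolding survives_def by (auto simp: le_Suc_eq)
    then show "g (history X t x) (X (Suc t) x) =
        ennreal (trunc_expectation H N (walk X s (Suc t) x)) *
        indicator {x. survives X H N s (Suc t) x} x"
      unfolding g_def next_walk F_def
      by (auto simp: alive[symmetric] indicator_def trunc_expectation_stopped)
  qed
  finally show ?thesis .
qed

theorem expectation_stopping_time:
  assumes dice: "iid_dice M X"
  shows "(\<integral>\<^sup>+ x. ennreal_of_enat (min (hit_time X H s x) (exceed_time X N s x)) \<partial>M) =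
           ennreal (trunc_expectation H N s)"
proof -
  interpret prob_space M by (rule iid_dice_prob_space[OF dice])
  define a where "a t = emeasure M {x \<in> space M. survives X H N s t x}" for t
  define b where "b t = surviving_mass M X H N s t" for t
  have telescope: "b 0 = (\<Sum>t<n. a t) + b n" for n
  proof (induction n)
    case (Suc n)
    then show ?case
      using surviving_mass_step[OF dice, of H N s n] by (simp add: a_def b_def add.assoc)
  qed simp
  have b0: "b 0 = ennreal (trunc_expectation H N s)"
  proof -
    have "b 0 = (\<integral>\<^sup>+ x. ennreal (trunc_expectation H N s) \<partial>M)"
      unfolding b_def surviving_mass_def
      by (rule nn_integral_cong)
        (auto simp: walk_def survives_def indicator_def trunc_expectation_stopped not_le)
    then show ?thesis by (simp add: emeasure_space_1)
  qed
  have dead: "AE x in M. \<not> survives X H N s t x" if "t > N" for t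
    using AE_walk_ge[OF dice, of t s]
    by eventually_elim (use that in \<open>auto simp: survives_def intro!: exI[of _ t]\<close>)
  have a_dead: "a t = 0" if "t > N" for t
    using dead[OF that] sets_survives[OF dice, of H N s t]
    unfolding a_def by (subst (asm) AE_iff_measurable[OF _ refl]) auto
  have b_dead: "b (Suc N) = 0"
  proof -
    have "b (Suc N) = (\<integral>\<^sup>+ x. 0 \<partial>M)"
      unfolding b_def surviving_mass_def using dead[of "Suc N"]
      by (intro nn_integral_cong_AE) auto
    then show ?thesis by simp
  qed
  have "(\<integral>\<^sup>+ x. ennreal_of_enat (min (hit_time X H s x) (exceed_time X N s x)) \<partial>M) = (\<Sum>t. a t)"
    unfolding a_def less_stopping_time_iff[symmetric]
    by (rule nn_integral_enat_function[OF measurable_compose2_countable[OF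
          measurable_hit_time[OF dice] measurable_exceed_time[OF dice]]])
  also have "\<dots> = (\<Sum>t<Suc N. a t)"
    by (rule suminf_finite) (auto intro: a_dead)
  also have "\<dots> = ennreal (trunc_expectation H N s)"
    using telescope[of "Suc N"] b0 b_dead by simp
  finally show ?thesis .
qed

section \<open>Decomposition of the hitting time\<close>

text \<open>Truncation makes this hold whichever time comes first, and also for infinite times.\<close>

lemma min_plus_excess_eq: "(T :: enat) = min T \<omega> + (T - \<omega>)"
  by (cases T; cases \<omega>) (auto simp: min_def)

lemma AE_exceed_time_finite:
  assumes "iid_dice M X"
  shows "AE x in M. exceed_time X N s x \<noteq> \<infinity>"
  using AE_walk_ge[OF assms, of "Suc N" s]
proof eventually_elim
  case (elim x)
  then have "exceed_time X N s x \<le> enat (Suc N)"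
    unfolding exceed_time_def by (intro Inf_lower) auto
  then show ?case by (cases "exceed_time X N s x") auto
qed

text \<open>In \<^typ>\<open>enat\<close> the difference \<open>\<infinity> - \<infinity>\<close> is \<open>\<infinity>\<close>, so off the overshoot event the excess is
  zero except where both times are infinite. That exception is a null set, as the exceedance time is
  almost surely finite.\<close>

lemma expected_hit_time_decompose:
  assumes dice: "iid_dice M X" and pos: "measure M (overshoot M X H N s) > 0"
  shows "expected_hit_time M X H s = ennreal (trunc_expectation H N s) +
           cond_expected_excess M X H N s * emeasure M (overshoot M X H N s)"
proof -
  interpret prob_space M by (rule iid_dice_prob_space[OF dice])
  let ?T = "hit_time X H s" and ?\<omega> = "exceed_time X N s" and ?A = "overshoot M X H N s"
  note joint = measurable_compose2_countable[OF measurable_hit_time[OF dice, of H s]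
      measurable_exceed_time[OF dice, of N s]]
  have A: "?A \<in> sets M"
    unfolding overshoot_def using joint[of "\<lambda>a b. b < a"] by (simp add: pred_def)
  have "(\<lambda>x. ennreal_of_enat (h (?T x) (?\<omega> x))) \<in> borel_measurable M" for h
    by (rule measurable_compose[OF joint]) auto
  note stopping = this[of min] and excess = this[of minus]
  have "expected_hit_time M X H s =
      (\<integral>\<^sup>+ x. ennreal_of_enat (min (?T x) (?\<omega> x)) + ennreal_of_enat (?T x - ?\<omega> x) \<partial>M)"
    unfolding expected_hit_time_def ennreal_of_enat_plus[symmetric]
    by (simp flip: min_plus_excess_eq)
  also have "\<dots> = ennreal (trunc_expectation H N s) + (\<integral>\<^sup>+ x. ennreal_of_enat (?T x - ?\<omega> x) \<partial>M)"
    by (subst nn_integral_add[OF stopping excess]) (simp add: expectation_stopping_time[OF dice])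
  also have "(\<integral>\<^sup>+ x. ennreal_of_enat (?T x - ?\<omega> x) \<partial>M) =
      (\<integral>\<^sup>+ x. ennreal_of_enat (?T x - ?\<omega> x) * indicator ?A x \<partial>M)"
  proof (rule nn_integral_cong_AE)
    show "AE x in M. ennreal_of_enat (?T x - ?\<omega> x) =
        ennreal_of_enat (?T x - ?\<omega> x) * indicator ?A x"
      using AE_exceed_time_finite[OF dice, of N s] AE_space
    proof eventually_elim
      case (elim x)
      have "?T x - ?\<omega> x = 0" if "?T x \<le> ?\<omega> x"
        using that elim(1) by (cases "?T x"; cases "?\<omega> x") (auto simp: zero_enat_def)
      with elim(2) show ?case
        by (auto simp: overshoot_def indicator_def not_less)
    qed
  qed
  also have "\<dots> = cond_expected_excess M X H N s * emeasure M ?A"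
    using pos unfolding cond_expected_excess_def nn_integral_uniform_measure[OF excess A]
    by (simp add: emeasure_eq_measure ennreal_divide_times ennreal_divide_self)
  finally show ?thesis .
qed

theorem theorem1:
  fixes M :: "'a measure" and X :: "nat \<Rightarrow> 'a \<Rightarrow> nat"
    and H :: "nat set" and N :: nat and L U :: real
  assumes "iid_dice M X"
    and "L < U"
    and "\<And>s. s \<le> N \<Longrightarrow> measure M (overshoot M X H N s) > 0 \<Longrightarrow>
           ereal L < enn2ereal (cond_expected_excess M X H N s) \<and>
           enn2ereal (cond_expected_excess M X H N s) < ereal U"
  shows "\<forall>s\<le>N. measure M (overshoot M X H N s) > 0 \<longrightarrow>
           0 < enn2ereal (expected_hit_time M X H s)
                 - ereal (trunc_expectation H N s + L * measure M (overshoot M X H N s)) \<and>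
           enn2ereal (expected_hit_time M X H s)
                 - ereal (trunc_expectation H N s + L * measure M (overshoot M X H N s))
             < ereal ((U - L) * measure M (overshoot M X H N s))"
proof (intro allI impI)
  fix s assume s: "s \<le> N" and pos: "measure M (overshoot M X H N s) > 0"
  interpret prob_space M by (rule iid_dice_prob_space[OF assms(1)])
  let ?f = "trunc_expectation H N s" and ?p = "measure M (overshoot M X H N s)"
  from assms(3)[OF s pos]
  have lower: "ereal L < enn2ereal (cond_expected_excess M X H N s)"
    and upper: "enn2ereal (cond_expected_excess M X H N s) < ereal U" by auto
  \<comment> \<open>The upper bound makes the conditional expectation finite, so all that follows is real arithmetic.\<close>
  from upper obtain c where c: "c \<ge> 0" "cond_expected_excess M X H N s = ennreal c"
    by (cases "cond_expected_excess M X H N s") auto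
  have "L < c" "c < U"
    using lower upper c by auto
  then have "L * ?p < c * ?p" "c * ?p < U * ?p"
    using pos by auto
  moreover have "expected_hit_time M X H s = ennreal (?f + c * ?p)"
    using expected_hit_time_decompose[OF assms(1) pos] c trunc_expectation_nonneg[of H N s]
    by (simp add: emeasure_eq_measure ennreal_mult)
  then have "enn2ereal (expected_hit_time M X H s) = ereal (?f + c * ?p)"
    using c trunc_expectation_nonneg[of H N s] by (simp del: ennreal_plus)
  ultimately show "0 < enn2ereal (expected_hit_time M X H s) - ereal (?f + L * ?p) \<and>
      enn2ereal (expected_hit_time M X H s) - ereal (?f + L * ?p) < ereal ((U - L) * ?p)"
    by (simp add: algebra_simps)
qed

end
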